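(* Let $M$ be a commutative monoid (written additively), let $(\mathbb X,T)$ be a tangent category, and let $\dim$ be an $M$-valued tangent dimension on $(\mathbb X,T)$. Then for every object $X$ of $\mathbb X$, $$\dim(T^2(X)) + 2\cdot \dim(X) = 3\cdot \dim(T(X)).$$
   Context: Additive bundles. An additive bundle $(X,A,p,+,0)$ over an object $A$ of a category is a morphism $p:X\to A$ all of whose finite pullback powers $X_n$ (the $n$-fold fibre product of $X$ with itself over $A$) exist, together with morphisms $+:X_2\to X$ and $0:A\to X$ such that $p\circ + = p\circ\pi_0=p\circ\pi_1$, $p\circ 0=1_A$, and $+$ is associative, commutative and unital with unit $0$ (i.e. $+\circ\langle 0\circ p,1_X\rangle=1_X$). An additive bundle morphism $(X,A,p,+,0)\to(Y,B,p',+',0')$ is a pair $f:X\to Y$, $g:A\to B$ with $p'\circ f=g\circ p$, $f\circ + = +'\circ\langle f\pi_0,f\pi_1\rangle$ and $f\circ 0=0'\circ g$. Tangent category. A tangent category $(\mathbb X,T,p,0,+,\ell,c)$, abbreviated $(\mathbb X,T)$, consists of a category $\mathbb X$ and: a functor $T:\mathbb X\to\mathbb X$ and a natural transformation $p:T\to 1$ such that all pullback powers $T_nM$ of $p_M:TM\to M$ exist and are preserved by $T$; natural transformations $+:T_2\to T$ and $0:1\to T$ making each $(TM,M,p_M,+_M,0_M)$ an additive bundle; a natural transformation $\ell:T\to T^2$ such that $(\ell_M,0_M)$ is an additive bundle morphism from $(TM,M,p_M,+_M,0_M)$ to $(T^2M,TM,T(p_M),T(+_M),T(0_M))$; a natural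 transformation $c:T^2\to T^2$ with $c\circ c=1$ and $c\circ\ell=\ell$ such that $(c_M,1)$ is an additive bundle morphism from $(T^2M,TM,T(p_M),T(+_M),T(0_M))$ to $(T^2M,TM,p_{TM},+_{TM},0_{TM})$. Moreover $T(\ell_M)\circ\ell_M=\ell_{TM}\circ\ell_M$, $c_{TM}\circ T(c_M)\circ c_{TM}=T(c_M)\circ c_{TM}\circ T(c_M)$, $c_{TM}\circ T(c_M)\circ\ell_{TM}=T(\ell_M)\circ c_M$, and (universality of the vertical lift) the commutative square with top $\nu:T_2M\to T^2M$, $\nu=T(+_M)\circ\langle\ell_M\circ\pi_0,0_{TM}\circ\pi_1\rangle$, left side $p_M\circ\pi_0:T_2M\to M$, right side $T(p_M):T^2M\to TM$ and bottom $0_M:M\to TM$ is a pullback preserved by all powers of $T$. Here $T^2=T\circ T$, while $T_2$ denotes the pullback of $p$ along itself. Tangent dimension. $\pi_0(\mathbb X)$ denotes the collection of isomorphism classes of objects of $\mathbb X$. A $T$-pullback is a pullback square preserved by all powers of $T$. An $M$-valued tangent dimension on $(\mathbb X,T)$ is a function $\dim:\pi_0(\mathbb X)\to M$ such that for every $T$-pullback $A\times_B C$ of a morphism $f:C\to B$ along a retraction (split epimorphism) $r:A\to B$, if $f$ is a retraction or $f$ is a section (split monomorphism), then $\dim(A\times_B C)+\dim(B)=\dim(A)+\dim(C)$. *)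

theory Defs
  imports Main
begin

section \<open>Categories\<close>

record ('o, 'a) category_data =
  Obj :: "'o set"
  Arr :: "'a set"
  Dom :: "'a \<Rightarrow> 'o"
  Cod :: "'a \<Rightarrow> 'o"
  Ident :: "'o \<Rightarrow> 'a" ("\<one>\<index>")
  Comp :: "'a \<Rightarrow> 'a \<Rightarrow> 'a" (infixr "\<odot>\<index>" 70)

definition hom :: "('o, 'a, 'z) category_data_scheme \<Rightarrow> 'o \<Rightarrow> 'o \<Rightarrow> 'a set" where
  "hom C x y = {f \<in> Arr C. Dom C f = x \<and> Cod C f = y}"

locale category =
  fixes C :: "('o, 'a, 'z) category_data_scheme" (structure)
  assumes Dom_Obj: "f \<in> Arr C \<Longrightarrow> Dom C f \<in> Obj C"
    and Cod_Obj: "f \<in> Arr C \<Longrightarrow> Cod C f \<in> Obj C"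
    and Ident_hom: "x \<in> Obj C \<Longrightarrow> \<one> x \<in> hom C x x"
    and Comp_hom: "\<lbrakk>f \<in> hom C x y; g \<in> hom C y z\<rbrakk> \<Longrightarrow> g \<odot> f \<in> hom C x z"
    and Comp_Ident: "f \<in> hom C x y \<Longrightarrow> f \<odot> \<one> x = f"
    and Ident_Comp: "f \<in> hom C x y \<Longrightarrow> \<one> y \<odot> f = f"
    and Comp_assoc: "\<lbrakk>f \<in> hom C w x; g \<in> hom C x y; h \<in> hom C y z\<rbrakk>
      \<Longrightarrow> h \<odot> (g \<odot> f) = (h \<odot> g) \<odot> f"

definition retraction :: "('o, 'a, 'z) category_data_scheme \<Rightarrow> 'a \<Rightarrow> bool" where
  "retraction C f \<longleftrightarrow> f \<in> Arr C \<and>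
     (\<exists>s \<in> hom C (Cod C f) (Dom C f). f \<odot>\<^bsub>C\<^esub> s = \<one>\<^bsub>C\<^esub> (Cod C f))"

definition section_arr :: "('o, 'a, 'z) category_data_scheme \<Rightarrow> 'a \<Rightarrow> bool" where
  "section_arr C f \<longleftrightarrow> f \<in> Arr C \<and>
     (\<exists>r \<in> hom C (Cod C f) (Dom C f). r \<odot>\<^bsub>C\<^esub> f = \<one>\<^bsub>C\<^esub> (Dom C f))"

definition iso_rel :: "('o, 'a, 'z) category_data_scheme \<Rightarrow> ('o \<times> 'o) set" where
  "iso_rel C = {(x, y). x \<in> Obj C \<and> y \<in> Obj C \<and>
     (\<exists>f \<in> hom C x y. \<exists>g \<in> hom C y x. g \<odot>\<^bsub>C\<^esub> f = \<one>\<^bsub>C\<^esub> x \<and> f \<odot>\<^bsub>C\<^esub> g = \<one>\<^bsub>C\<^esub> y)}"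

definition iso_class :: "('o, 'a, 'z) category_data_scheme \<Rightarrow> 'o \<Rightarrow> 'o set" where
  "iso_class C x = iso_rel C `` {x}"

section \<open>Pullbacks and pullback powers\<close>

text \<open>
  In \<open>is_pullback C P a b f g\<close>, the cospan is \<open>f, g\<close>, the apex is \<open>P\<close>, and the projections are
  \<open>a\<close> (to the domain of \<open>f\<close>) and \<open>b\<close> (to the domain of \<open>g\<close>).
\<close>

definition is_pullback ::
  "('o, 'a, 'z) category_data_scheme \<Rightarrow> 'o \<Rightarrow> 'a \<Rightarrow> 'a \<Rightarrow> 'a \<Rightarrow> 'a \<Rightarrow> bool" where
  "is_pullback C P a b f g \<longleftrightarrow>
     f \<in> Arr C \<and> g \<in> Arr C \<and> Cod C f = Cod C g \<and>
     a \<in> hom C P (Dom C f) \<and> b \<in> hom C P (Dom C g) \<and> f \<odot>\<^bsub>C\<^esub> a = g \<odot>\<^bsub>C\<^esub> b \<and>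
     (\<forall>Q \<in> Obj C. \<forall>u \<in> hom C Q (Dom C f). \<forall>v \<in> hom C Q (Dom C g).
        f \<odot>\<^bsub>C\<^esub> u = g \<odot>\<^bsub>C\<^esub> v \<longrightarrow> (\<exists>!h. h \<in> hom C Q P \<and> a \<odot>\<^bsub>C\<^esub> h = u \<and> b \<odot>\<^bsub>C\<^esub> h = v))"

text \<open>
  The \<open>n\<close>-fold fibre product of \<open>X\<close> with itself over \<open>A\<close>, for \<open>p : X \<rightarrow> A\<close>, is the \<open>n\<close>-fold
  product of \<open>p\<close> in the slice over \<open>A\<close>: it carries a structure map \<open>q : P \<rightarrow> A\<close> and projections
  \<open>pr i : P \<rightarrow> X\<close> for \<open>i < n\<close>. Recording \<open>q\<close> makes the case \<open>n = 0\<close> meaningful (then \<open>q\<close> is an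
  isomorphism).
\<close>

definition is_pullback_power ::
  "('o, 'a, 'z) category_data_scheme \<Rightarrow> nat \<Rightarrow> 'a \<Rightarrow> 'o \<Rightarrow> 'a \<Rightarrow> (nat \<Rightarrow> 'a) \<Rightarrow> bool" where
  "is_pullback_power C n p P q pr \<longleftrightarrow>
     p \<in> Arr C \<and> q \<in> hom C P (Cod C p) \<and>
     (\<forall>i<n. pr i \<in> hom C P (Dom C p) \<and> p \<odot>\<^bsub>C\<^esub> pr i = q) \<and>
     (\<forall>Q \<in> Obj C. \<forall>r \<in> hom C Q (Cod C p). \<forall>u.
        (\<forall>i<n. u i \<in> hom C Q (Dom C p) \<and> p \<odot>\<^bsub>C\<^esub> u i = r) \<longrightarrow>
        (\<exists>!h. h \<in> hom C Q P \<and> q \<odot>\<^bsub>C\<^esub> h = r \<and> (\<forall>i<n. pr i \<odot>\<^bsub>C\<^esub> h = u i)))"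

text \<open>
  The arrow \<open>\<langle>u, v\<rangle>\<close> into a pullback with apex \<open>P\<close> and projections \<open>a\<close>, \<open>b\<close>. It is meaningful
  only where \<open>u\<close>, \<open>v\<close> form a cone over the underlying cospan.
\<close>

definition pairing ::
  "('o, 'a, 'z) category_data_scheme \<Rightarrow> 'o \<Rightarrow> 'a \<Rightarrow> 'a \<Rightarrow> 'a \<Rightarrow> 'a \<Rightarrow> 'a" where
  "pairing C P a b u v = (THE h. h \<in> hom C (Dom C u) P \<and> a \<odot>\<^bsub>C\<^esub> h = u \<and> b \<odot>\<^bsub>C\<^esub> h = v)"

section \<open>Endofunctors and natural transformations\<close>

record ('o, 'a) endofunctor_data =
  FObj :: "'o \<Rightarrow> 'o"
  FArr :: "'a \<Rightarrow> 'a"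

definition endofunctor ::
  "('o, 'a, 'z) category_data_scheme \<Rightarrow> ('o, 'a) endofunctor_data \<Rightarrow> bool" where
  "endofunctor C F \<longleftrightarrow>
     (\<forall>x \<in> Obj C. FObj F x \<in> Obj C) \<and>
     (\<forall>x y. \<forall>f \<in> hom C x y. FArr F f \<in> hom C (FObj F x) (FObj F y)) \<and>
     (\<forall>x \<in> Obj C. FArr F (\<one>\<^bsub>C\<^esub> x) = \<one>\<^bsub>C\<^esub> (FObj F x)) \<and>
     (\<forall>x y z. \<forall>f \<in> hom C x y. \<forall>g \<in> hom C y z.
        FArr F (g \<odot>\<^bsub>C\<^esub> f) = FArr F g \<odot>\<^bsub>C\<^esub> FArr F f)"

definition id_functor :: "('o, 'a) endofunctor_data" where
  "id_functor = \<lparr>FObj = id, FArr = id\<rparr>"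

definition comp_functor ::
  "('o, 'a) endofunctor_data \<Rightarrow> ('o, 'a) endofunctor_data \<Rightarrow> ('o, 'a) endofunctor_data" where
  "comp_functor G F = \<lparr>FObj = FObj G \<circ> FObj F, FArr = FArr G \<circ> FArr F\<rparr>"

definition natural_transformation ::
  "('o, 'a, 'z) category_data_scheme \<Rightarrow> ('o, 'a) endofunctor_data \<Rightarrow> ('o, 'a) endofunctor_data
    \<Rightarrow> ('o \<Rightarrow> 'a) \<Rightarrow> bool" where
  "natural_transformation C F G \<tau> \<longleftrightarrow> endofunctor C F \<and> endofunctor C G \<and>
     (\<forall>x \<in> Obj C. \<tau> x \<in> hom C (FObj F x) (FObj G x)) \<and>
     (\<forall>x y. \<forall>f \<in> hom C x y. \<tau> y \<odot>\<^bsub>C\<^esub> FArr F f = FArr G f \<odot>\<^bsub>C\<^esub> \<tau> x)"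

text \<open>A pullback square preserved by all powers of \<open>T\<close>; \<open>n = 0\<close> is the square itself.\<close>

definition T_pullback ::
  "('o, 'a, 'z) category_data_scheme \<Rightarrow> ('o, 'a) endofunctor_data
    \<Rightarrow> 'o \<Rightarrow> 'a \<Rightarrow> 'a \<Rightarrow> 'a \<Rightarrow> 'a \<Rightarrow> bool" where
  "T_pullback C T P a b f g \<longleftrightarrow>
     (\<forall>n. is_pullback C ((FObj T ^^ n) P) ((FArr T ^^ n) a) ((FArr T ^^ n) b)
            ((FArr T ^^ n) f) ((FArr T ^^ n) g))"

section \<open>Additive bundles\<close>

text \<open>
  The record includes a choice of the pullback \<open>X\<^sub>2\<close> with its projections, because the addition
  is a morphism out of it.
\<close>

record ('o, 'a) bundle_data =
  Total :: 'o
  Base :: 'o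
  bproj :: 'a
  Pow2 :: 'o
  bfst :: 'a
  bsnd :: 'a
  badd :: 'a
  bzero :: 'a

definition bpair :: "('o, 'a, 'z) category_data_scheme \<Rightarrow> ('o, 'a) bundle_data \<Rightarrow> 'a \<Rightarrow> 'a \<Rightarrow> 'a" where
  "bpair C B u v = pairing C (Pow2 B) (bfst B) (bsnd B) u v"

locale additive_bundle = category C
  for C :: "('o, 'a, 'z) category_data_scheme" (structure) +
  fixes B :: "('o, 'a) bundle_data"
  assumes bproj_hom: "bproj B \<in> hom C (Total B) (Base B)"
    and powers_exist: "\<exists>P q pr. is_pullback_power C n (bproj B) P q pr"
    and Pow2_pullback: "is_pullback C (Pow2 B) (bfst B) (bsnd B) (bproj B) (bproj B)"
    and badd_hom: "badd B \<in> hom C (Pow2 B) (Total B)"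
    and bzero_hom: "bzero B \<in> hom C (Base B) (Total B)"
    and bproj_badd_fst: "bproj B \<odot> badd B = bproj B \<odot> bfst B"
    and bproj_badd_snd: "bproj B \<odot> badd B = bproj B \<odot> bsnd B"
    and bproj_bzero: "bproj B \<odot> bzero B = \<one> (Base B)"
    and badd_assoc: "is_pullback_power C 3 (bproj B) P q pr \<Longrightarrow>
        badd B \<odot> bpair C B (badd B \<odot> bpair C B (pr 0) (pr 1)) (pr 2) =
        badd B \<odot> bpair C B (pr 0) (badd B \<odot> bpair C B (pr 1) (pr 2))"
    and badd_comm: "badd B \<odot> bpair C B (bsnd B) (bfst B) = badd B"
    and badd_unit: "badd B \<odot> bpair C B (bzero B \<odot> bproj B) (\<one> (Total B)) = \<one> (Total B)"

definition additive_bundle_morphism ::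
  "('o, 'a, 'z) category_data_scheme \<Rightarrow> ('o, 'a) bundle_data \<Rightarrow> ('o, 'a) bundle_data
    \<Rightarrow> 'a \<Rightarrow> 'a \<Rightarrow> bool" where
  "additive_bundle_morphism C B B' f g \<longleftrightarrow>
     additive_bundle C B \<and> additive_bundle C B' \<and>
     f \<in> hom C (Total B) (Total B') \<and> g \<in> hom C (Base B) (Base B') \<and>
     bproj B' \<odot>\<^bsub>C\<^esub> f = g \<odot>\<^bsub>C\<^esub> bproj B \<and>
     f \<odot>\<^bsub>C\<^esub> badd B = badd B' \<odot>\<^bsub>C\<^esub> bpair C B' (f \<odot>\<^bsub>C\<^esub> bfst B) (f \<odot>\<^bsub>C\<^esub> bsnd B) \<and>
     f \<odot>\<^bsub>C\<^esub> bzero B = bzero B' \<odot>\<^bsub>C\<^esub> g"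

definition map_bundle ::
  "('o, 'a) endofunctor_data \<Rightarrow> ('o, 'a) bundle_data \<Rightarrow> ('o, 'a) bundle_data" where
  "map_bundle F B = \<lparr>Total = FObj F (Total B), Base = FObj F (Base B), bproj = FArr F (bproj B),
     Pow2 = FObj F (Pow2 B), bfst = FArr F (bfst B), bsnd = FArr F (bsnd B),
     badd = FArr F (badd B), bzero = FArr F (bzero B)\<rparr>"

section \<open>Tangent categories\<close>

text \<open>
  The parameters \<open>T2\<close>, \<open>\<pi>\<^sub>0\<close>, \<open>\<pi>\<^sub>1\<close> choose, for each object \<open>M\<close>, a pullback of \<open>p\<^sub>M\<close> along itself;
  \<open>z\<close>, \<open>add\<close>, \<open>l\<close> and \<open>c\<close> are the zero, the addition, the vertical lift and the canonical flip.
\<close>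

locale tangent_data =
  fixes C :: "('o, 'a, 'z) category_data_scheme" (structure)
    and T :: "('o, 'a) endofunctor_data"
    and p :: "'o \<Rightarrow> 'a"
    and T2 :: "'o \<Rightarrow> 'o"
    and \<pi>\<^sub>0 :: "'o \<Rightarrow> 'a"
    and \<pi>\<^sub>1 :: "'o \<Rightarrow> 'a"
    and z :: "'o \<Rightarrow> 'a"
    and add :: "'o \<Rightarrow> 'a"
    and l :: "'o \<Rightarrow> 'a"
    and c :: "'o \<Rightarrow> 'a"
begin

definition tangent_bundle :: "'o \<Rightarrow> ('o, 'a) bundle_data" where
  "tangent_bundle M = \<lparr>Total = FObj T M, Base = M, bproj = p M,
     Pow2 = T2 M, bfst = \<pi>\<^sub>0 M, bsnd = \<pi>\<^sub>1 M, badd = add M, bzero = z M\<rparr>"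

text \<open>\<open>T\<^sub>2\<close> acts on \<open>f : M \<rightarrow> N\<close> as \<open>\<langle>T(f) \<pi>\<^sub>0, T(f) \<pi>\<^sub>1\<rangle>\<close>.\<close>

definition T2_functor :: "('o, 'a) endofunctor_data" where
  "T2_functor = \<lparr>FObj = T2,
     FArr = (\<lambda>f. bpair C (tangent_bundle (Cod C f))
                  (FArr T f \<odot> \<pi>\<^sub>0 (Dom C f)) (FArr T f \<odot> \<pi>\<^sub>1 (Dom C f)))\<rparr>"

text \<open>The pairing lands in \<open>T(T\<^sub>2M)\<close>, the pullback of \<open>T(p\<^sub>M)\<close> along itself.\<close>

definition \<nu> :: "'o \<Rightarrow> 'a" where
  "\<nu> M = FArr T (add M) \<odot>
     bpair C (map_bundle T (tangent_bundle M)) (l M \<odot> \<pi>\<^sub>0 M) (z (FObj T M) \<odot> \<pi>\<^sub>1 M)"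

end

locale tangent_category =
  category C + tangent_data C T p T2 \<pi>\<^sub>0 \<pi>\<^sub>1 z add l c
  for C :: "('o, 'a, 'z) category_data_scheme" (structure)
    and T p T2 \<pi>\<^sub>0 \<pi>\<^sub>1 z add l c +
  assumes T_endofunctor: "endofunctor C T"
    and p_natural: "natural_transformation C T id_functor p"
    and T_powers_exist: "M \<in> Obj C \<Longrightarrow> \<exists>P q pr. is_pullback_power C n (p M) P q pr"
    and T_powers_preserved: "\<lbrakk>M \<in> Obj C; is_pullback_power C n (p M) P q pr\<rbrakk> \<Longrightarrow>
        is_pullback_power C n (FArr T (p M)) (FObj T P) (FArr T q) (\<lambda>i. FArr T (pr i))"
    and T2_pullback: "M \<in> Obj C \<Longrightarrow> is_pullback C (T2 M) (\<pi>\<^sub>0 M) (\<pi>\<^sub>1 M) (p M) (p M)"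
    and add_natural: "natural_transformation C T2_functor T add"
    and z_natural: "natural_transformation C id_functor T z"
    and tangent_additive: "M \<in> Obj C \<Longrightarrow> additive_bundle C (tangent_bundle M)"
    and l_natural: "natural_transformation C T (comp_functor T T) l"
    and l_additive: "M \<in> Obj C \<Longrightarrow> additive_bundle_morphism C
        (tangent_bundle M) (map_bundle T (tangent_bundle M)) (l M) (z M)"
    and c_natural: "natural_transformation C (comp_functor T T) (comp_functor T T) c"
    and c_involutive: "M \<in> Obj C \<Longrightarrow> c M \<odot> c M = \<one> (FObj T (FObj T M))"
    and c_l: "M \<in> Obj C \<Longrightarrow> c M \<odot> l M = l M"
    and c_additive: "M \<in> Obj C \<Longrightarrow> additive_bundle_morphism C
        (map_bundle T (tangent_bundle M)) (tangent_bundle (FObj T M)) (c M) (\<one> (FObj T M))"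
    and l_coassoc: "M \<in> Obj C \<Longrightarrow> FArr T (l M) \<odot> l M = l (FObj T M) \<odot> l M"
    and c_braid: "M \<in> Obj C \<Longrightarrow>
        c (FObj T M) \<odot> FArr T (c M) \<odot> c (FObj T M) = FArr T (c M) \<odot> c (FObj T M) \<odot> FArr T (c M)"
    and c_l_compat: "M \<in> Obj C \<Longrightarrow>
        c (FObj T M) \<odot> FArr T (c M) \<odot> l (FObj T M) = FArr T (l M) \<odot> c M"
    and lift_universal: "M \<in> Obj C \<Longrightarrow>
        T_pullback C T (T2 M) (\<nu> M) (p M \<odot> \<pi>\<^sub>0 M) (FArr T (p M)) (z M)"

section \<open>Tangent dimension\<close>

text \<open>
  A dimension is a function on isomorphism classes, i.e. on the quotient
  \<open>Obj C // iso_rel C\<close>; its values on other sets of objects play no role.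
\<close>

definition tangent_dimension ::
  "('o, 'a, 'z) category_data_scheme \<Rightarrow> ('o, 'a) endofunctor_data
    \<Rightarrow> ('o set \<Rightarrow> 'm::comm_monoid_add) \<Rightarrow> bool" where
  "tangent_dimension C T dim \<longleftrightarrow>
     (\<forall>P X Y Z a b r f.
        r \<in> hom C X Y \<and> f \<in> hom C Z Y \<and> retraction C r \<and> (retraction C f \<or> section_arr C f) \<and>
        T_pullback C T P a b r f \<longrightarrow>
        dim (iso_class C P) + dim (iso_class C Y) = dim (iso_class C X) + dim (iso_class C Z))"

definition nat_mult :: "nat \<Rightarrow> 'm::comm_monoid_add \<Rightarrow> 'm" where
  "nat_mult n x = (\<Sum>i<n. x)"

end

theory Submission
  imports Defs
begin

text \<open>
  Universality of the vertical lift is a \<open>T\<close>-pullback of the retraction \<open>T(p)\<close> along the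
  section \<open>0\<close>, so \<open>dim(T\<^sub>2X) + dim(TX) = dim(T\<^sup>2X) + dim(X)\<close>. The pullback of the
  retraction \<open>p\<close> along itself gives \<open>dim(T\<^sub>2X) + dim(X) = 2 dim(TX)\<close>, and adding \<open>dim(X)\<close> to
  the first equation finishes the proof. The axioms only provide that a single application
  of \<open>T\<close> preserves the pullback powers of \<open>p\<close>; the canonical flip identifies \<open>T(p\<^sub>M)\<close> with
  \<open>p\<close> at \<open>TM\<close>, which yields preservation by all powers of \<open>T\<close>.
\<close>

lemma hom_iff: "f \<in> hom C x y \<longleftrightarrow> f \<in> Arr C \<and> Dom C f = x \<and> Cod C f = y"
  by (simp add: hom_def)

section \<open>Pullbacks, pullback powers and change of cospan\<close>

context category
begin

text \<open>Bridges two formulations: the tangent axioms preserve pullback powers, whereas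
  \<open>T_pullback\<close> speaks of squares. The structure map of the power is the diagonal of the
  square.\<close>

lemma is_pullback_imp_power:
  assumes "is_pullback C P a b f f"
  shows "is_pullback_power C 2 f P (f \<odot> a) (\<lambda>i. if i = 0 then a else b)"
proof -
  let ?X = "Dom C f" and ?Y = "Cod C f" and ?pr = "\<lambda>i::nat. if i = 0 then a else b"
  have f: "f \<in> hom C ?X ?Y" and a: "a \<in> hom C P ?X" and b: "b \<in> hom C P ?X"
    and eq: "f \<odot> a = f \<odot> b"
    using assms by (auto simp: is_pullback_def hom_iff)
  have univ: "\<exists>!h. h \<in> hom C Q P \<and> (f \<odot> a) \<odot> h = r \<and> (\<forall>i<2. ?pr i \<odot> h = u i)"
    if Q: "Q \<in> Obj C" and u: "\<forall>i<2. u i \<in> hom C Q ?X \<and> f \<odot> u i = r" for Q r u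
  proof -
    have u0: "u 0 \<in> hom C Q ?X" "f \<odot> u 0 = r" and u1: "u (1::nat) \<in> hom C Q ?X" "f \<odot> u 1 = r"
      using u by auto
    then have "\<exists>!h. h \<in> hom C Q P \<and> a \<odot> h = u 0 \<and> b \<odot> h = u 1"
      using assms Q unfolding is_pullback_def by simp
    \<comment> \<open>The clause on the structure map is implied by the one on the first projection:
      (f a) h = f (a h) = f (u 0) = r. So both universal properties single out the same
      \<open>h\<close>.\<close>
    moreover have "h \<in> hom C Q P \<and> (f \<odot> a) \<odot> h = r \<and> (\<forall>i<2. ?pr i \<odot> h = u i)
        \<longleftrightarrow> h \<in> hom C Q P \<and> a \<odot> h = u 0 \<and> b \<odot> h = u 1" for h
      using Comp_assoc[OF _ a f, of h Q] u0(2) by (auto simp: less_2_cases_iff)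
    ultimately show ?thesis
      by simp
  qed
  show ?thesis
    unfolding is_pullback_power_def using f a b eq univ Comp_hom[OF a f] by (simp add: hom_iff)
qed

text \<open>The way back to squares, applied after the functor has acted on the power. A cone
  \<open>u\<close>, \<open>v\<close> is read as a two-element family over the base map f u = f
  v.\<close>

lemma pullback_power_imp_is_pullback:
  assumes "is_pullback_power C 2 f P q pr"
  shows "is_pullback C P (pr 0) (pr 1) f f"
proof -
  let ?X = "Dom C f" and ?Y = "Cod C f"
  have f: "f \<in> hom C ?X ?Y"
    and pr0: "pr 0 \<in> hom C P ?X" "f \<odot> pr 0 = q" and pr1: "pr 1 \<in> hom C P ?X" "f \<odot> pr 1 = q"
    using assms by (auto simp: is_pullback_power_def hom_iff)
  have univ: "\<exists>!h. h \<in> hom C Q P \<and> pr 0 \<odot> h = u \<and> pr 1 \<odot> h = v"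
    if Q: "Q \<in> Obj C" and u: "u \<in> hom C Q ?X" and v: "v \<in> hom C Q ?X"
      and uv: "f \<odot> u = f \<odot> v" for Q u v
  proof -
    let ?w = "\<lambda>i::nat. if i = 0 then u else v"
    have all: "\<forall>r \<in> hom C Q ?Y. \<forall>w. (\<forall>i<2. w i \<in> hom C Q ?X \<and> f \<odot> w i = r) \<longrightarrow>
        (\<exists>!h. h \<in> hom C Q P \<and> q \<odot> h = r \<and> (\<forall>i<2. pr i \<odot> h = w i))"
      using assms Q unfolding is_pullback_power_def by (elim conjE) (rule bspec)
    have "\<forall>i<2. ?w i \<in> hom C Q ?X \<and> f \<odot> ?w i = f \<odot> u"
      using u v uv by simp
    then have "\<exists>!h. h \<in> hom C Q P \<and> q \<odot> h = f \<odot> u \<and> (\<forall>i<2. pr i \<odot> h = ?w i)"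
      by (rule mp[OF spec[OF bspec[OF all Comp_hom[OF u f]], where x = ?w]])
    moreover have "h \<in> hom C Q P \<and> q \<odot> h = f \<odot> u \<and> (\<forall>i<2. pr i \<odot> h = ?w i)
        \<longleftrightarrow> h \<in> hom C Q P \<and> pr 0 \<odot> h = u \<and> pr 1 \<odot> h = v" for h
      using Comp_assoc[OF _ pr0(1) f, of h Q] pr0(2) by (auto simp: less_2_cases_iff)
    ultimately show ?thesis
      by simp
  qed
  show ?thesis
    unfolding is_pullback_def
    using f[unfolded hom_iff] pr0 pr1 univ by (intro conjI ballI impI) (simp_all only:)
qed

text \<open>An isomorphism \<open>i\<close> inserted into both legs is compensated by its inverse
  \<open>j\<close> on the projections, with the apex unchanged. It serves to pass between T(p) and p
  along flips.\<close>

lemma is_pullback_iso_legs: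
  assumes pb: "is_pullback C P a b f f" and f: "f \<in> hom C X Y"
    and i: "i \<in> hom C X' X" and j: "j \<in> hom C X X'"
    and ij: "i \<odot> j = \<one> X" and ji: "j \<odot> i = \<one> X'"
  shows "is_pullback C P (j \<odot> a) (j \<odot> b) (f \<odot> i) (f \<odot> i)"
proof -
  have a: "a \<in> hom C P X" and b: "b \<in> hom C P X" and eq: "f \<odot> a = f \<odot> b"
    using pb f by (auto simp: is_pullback_def hom_iff)
  have fi: "f \<odot> i \<in> hom C X' Y"
    by (rule Comp_hom[OF i f])
  then have fi_Arr: "f \<odot> i \<in> Arr C" and fi_eqs: "Dom C (f \<odot> i) = X'" "Cod C (f \<odot> i) = Y"
    by (simp_all add: hom_iff)
  have cancel_ij: "i \<odot> (j \<odot> w) = w" if "w \<in> hom C Q X" for w Q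
    using that by (simp add: Comp_assoc[OF that j i] ij Ident_Comp)
  have cancel_ji: "j \<odot> (i \<odot> w) = w" if "w \<in> hom C Q X'" for w Q
    using that by (simp add: Comp_assoc[OF that i j] ji Ident_Comp)
  have leg: "(f \<odot> i) \<odot> (j \<odot> w) = f \<odot> w" if "w \<in> hom C Q X" for w Q
    using Comp_assoc[OF Comp_hom[OF that j] i f] cancel_ij[OF that] by simp
  have univ: "\<exists>!h. h \<in> hom C Q P \<and> (j \<odot> a) \<odot> h = u \<and> (j \<odot> b) \<odot> h = v"
    if Q: "Q \<in> Obj C" and u: "u \<in> hom C Q X'" and v: "v \<in> hom C Q X'"
      and uv: "(f \<odot> i) \<odot> u = (f \<odot> i) \<odot> v" for Q u v
  proof -
    have "f \<odot> (i \<odot> u) = f \<odot> (i \<odot> v)"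
      using uv Comp_assoc[OF u i f] Comp_assoc[OF v i f] by simp
    then have "\<exists>!h. h \<in> hom C Q P \<and> a \<odot> h = i \<odot> u \<and> b \<odot> h = i \<odot> v"
      using pb f Q Comp_hom[OF u i] Comp_hom[OF v i] unfolding is_pullback_def
      by (simp add: hom_iff)
    \<comment> \<open>Moving \<open>j\<close> across the equation as \<open>i\<close> turns the
      factorization problem for the new square into the one already solved for the old
      square.\<close>
    moreover have "(j \<odot> e) \<odot> h = w \<longleftrightarrow> e \<odot> h = i \<odot> w"
      if "e \<in> hom C P X" "h \<in> hom C Q P" "w \<in> hom C Q X'" for e h w
      using that cancel_ij[OF Comp_hom[OF that(2,1)]] cancel_ji[OF that(3)]
        Comp_assoc[OF that(2,1) j] by metis
    ultimately show ?thesis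
      using a b u v by (smt (verit, best))
  qed
  show ?thesis
    unfolding is_pullback_def fi_eqs
    using fi_Arr Comp_hom[OF a j] Comp_hom[OF b j] leg[OF a] leg[OF b] eq
    by (intro conjI ballI impI) (simp_all add: univ)
qed

end

lemma endofunctorD:
  assumes "endofunctor C F"
  shows "x \<in> Obj C \<Longrightarrow> FObj F x \<in> Obj C"
    and "f \<in> hom C x y \<Longrightarrow> FArr F f \<in> hom C (FObj F x) (FObj F y)"
    and "x \<in> Obj C \<Longrightarrow> FArr F (\<one>\<^bsub>C\<^esub> x) = \<one>\<^bsub>C\<^esub> (FObj F x)"
    and "f \<in> hom C x y \<Longrightarrow> g \<in> hom C y w \<Longrightarrow> FArr F (g \<odot>\<^bsub>C\<^esub> f) = FArr F g \<odot>\<^bsub>C\<^esub> FArr F f"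
  using assms unfolding endofunctor_def by blast+

lemma endofunctor_pow:
  assumes "endofunctor C F"
  shows "x \<in> Obj C \<Longrightarrow> (FObj F ^^ n) x \<in> Obj C"
    and "f \<in> hom C x y \<Longrightarrow> (FArr F ^^ n) f \<in> hom C ((FObj F ^^ n) x) ((FObj F ^^ n) y)"
  by (induction n) (simp_all add: endofunctorD[OF assms])

section \<open>Preservation of pullbacks of the projection by all powers of the tangent
  functor\<close>

context tangent_category
begin

lemma p_hom: "M \<in> Obj C \<Longrightarrow> p M \<in> hom C (FObj T M) M"
  using p_natural by (simp add: natural_transformation_def id_functor_def)

lemma z_hom: "M \<in> Obj C \<Longrightarrow> z M \<in> hom C M (FObj T M)"
  using z_natural by (simp add: natural_transformation_def id_functor_def)

lemma c_hom: "M \<in> Obj C \<Longrightarrow> c M \<in> hom C (FObj T (FObj T M)) (FObj T (FObj T M))"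
  using c_natural by (simp add: natural_transformation_def comp_functor_def)

lemma p_z: "M \<in> Obj C \<Longrightarrow> p M \<odot> z M = \<one> M"
  using additive_bundle.bproj_bzero[OF tangent_additive] by (simp add: tangent_bundle_def)

text \<open>The flip is a bundle morphism over the identity, so its compatibility with projections
  is exactly this equation.\<close>

lemma p_c:
  assumes "M \<in> Obj C"
  shows "p (FObj T M) \<odot> c M = FArr T (p M)"
  using c_additive[OF assms] endofunctorD(2)[OF T_endofunctor p_hom[OF assms]]
  by (simp add: additive_bundle_morphism_def tangent_bundle_def map_bundle_def Ident_Comp)

text \<open>A round trip through pullback powers of order 2, where the preservation axiom
  applies.\<close>

lemma T_preserves_pullback_of_p:
  assumes M: "M \<in> Obj C" and pb: "is_pullback C P a b (p M) (p M)"
  shows "is_pullback C (FObj T P) (FArr T a) (FArr T b) (FArr T (p M)) (FArr T (p M))"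
  using pullback_power_imp_is_pullback[OF T_powers_preserved[OF M is_pullback_imp_power[OF pb]]]
  by simp

text \<open>The iterated flip \<open>g : T\<^sup>n(TM) \<rightarrow> T(T\<^sup>nM)\<close>, with inverse \<open>g'\<close>, turns \<open>T\<^sup>n(p\<^sub>M)\<close> into \<open>p\<close>.\<close>

lemma pow_pullback_of_p:
  assumes M: "M \<in> Obj C" and pb: "is_pullback C P a b (p M) (p M)"
  shows "\<exists>g g'. g \<in> hom C ((FObj T ^^ n) (FObj T M)) (FObj T ((FObj T ^^ n) M))
    \<and> g' \<in> hom C (FObj T ((FObj T ^^ n) M)) ((FObj T ^^ n) (FObj T M))
    \<and> g \<odot> g' = \<one> (FObj T ((FObj T ^^ n) M)) \<and> g' \<odot> g = \<one> ((FObj T ^^ n) (FObj T M))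
    \<and> p ((FObj T ^^ n) M) \<odot> g = (FArr T ^^ n) (p M)
    \<and> is_pullback C ((FObj T ^^ n) P) (g \<odot> (FArr T ^^ n) a) (g \<odot> (FArr T ^^ n) b)
        (p ((FObj T ^^ n) M)) (p ((FObj T ^^ n) M))"
proof (induction n)
  case 0
  \<comment> \<open>With no iterations the flip is the identity of TM, its own inverse.\<close>
  have "a \<in> hom C P (FObj T M)" "b \<in> hom C P (FObj T M)"
    using pb p_hom[OF M] by (auto simp: is_pullback_def hom_iff)
  moreover have "\<one> (FObj T M) \<in> hom C (FObj T M) (FObj T M)"
    by (rule Ident_hom[OF endofunctorD(1)[OF T_endofunctor M]])
  ultimately show ?case
    using pb Comp_Ident[OF p_hom[OF M]]
    by (intro exI[of _ "\<one> (FObj T M)"]) (simp add: Ident_Comp)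
next
  case (Suc n)
  let ?N = "(FObj T ^^ n) M" and ?A = "(FObj T ^^ n) (FObj T M)" and ?Q = "(FObj T ^^ n) P"
  let ?a = "(FArr T ^^ n) a" and ?b = "(FArr T ^^ n) b"
  note F = endofunctorD[OF T_endofunctor]
  obtain g g' where g: "g \<in> hom C ?A (FObj T ?N)" and g': "g' \<in> hom C (FObj T ?N) ?A"
    and gg': "g \<odot> g' = \<one> (FObj T ?N)" and g'g: "g' \<odot> g = \<one> ?A"
    and pg: "p ?N \<odot> g = (FArr T ^^ n) (p M)"
    and pbn: "is_pullback C ?Q (g \<odot> ?a) (g \<odot> ?b) (p ?N) (p ?N)"
    using Suc.IH by blast
  have N: "?N \<in> Obj C" and A: "?A \<in> Obj C"
    using endofunctor_pow(1)[OF T_endofunctor] F(1) M by auto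
  have TN: "FObj T ?N \<in> Obj C"
    by (rule F(1)[OF N])
  have a: "?a \<in> hom C ?Q ?A" and b: "?b \<in> hom C ?Q ?A"
    using pb p_hom[OF M]
    by (auto simp: is_pullback_def hom_iff[of "p M"] intro!: endofunctor_pow(2)[OF T_endofunctor])
  have c: "c ?N \<in> hom C (FObj T (FObj T ?N)) (FObj T (FObj T ?N))"
    and cc: "c ?N \<odot> c ?N = \<one> (FObj T (FObj T ?N))"
    by (rule c_hom[OF N], rule c_involutive[OF N])
  have Tg: "FArr T g \<in> hom C (FObj T ?A) (FObj T (FObj T ?N))"
    and Tg': "FArr T g' \<in> hom C (FObj T (FObj T ?N)) (FObj T ?A)"
    by (rule F(2)[OF g], rule F(2)[OF g'])
  have TgTg': "FArr T g \<odot> FArr T g' = \<one> (FObj T (FObj T ?N))"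
    using F(4)[OF g' g] gg' F(3)[OF TN] by simp
  have Tg'Tg: "FArr T g' \<odot> FArr T g = \<one> (FObj T ?A)"
    using F(4)[OF g g'] g'g F(3)[OF A] by simp
  have pTN: "p (FObj T ?N) \<in> hom C (FObj T (FObj T ?N)) (FObj T ?N)"
    by (rule p_hom[OF TN])
  \<comment> \<open>With N = T^n M, the next iterated flip first applies T to the previous one,
    reaching T(T N), and then swaps the two outer copies of T by \<open>c\<close> at N.\<close>
  let ?h = "c ?N \<odot> FArr T g" and ?h' = "FArr T g' \<odot> c ?N"
  have h: "?h \<in> hom C (FObj T ?A) (FObj T (FObj T ?N))"
    by (rule Comp_hom[OF Tg c])
  have h': "?h' \<in> hom C (FObj T (FObj T ?N)) (FObj T ?A)"
    by (rule Comp_hom[OF c Tg'])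
  have "?h \<odot> ?h' = c ?N \<odot> ((FArr T g \<odot> FArr T g') \<odot> c ?N)"
    by (simp add: Comp_assoc[OF h' Tg c, symmetric] Comp_assoc[OF c Tg' Tg])
  then have hh': "?h \<odot> ?h' = \<one> (FObj T (FObj T ?N))"
    by (simp add: TgTg' Ident_Comp[OF c] cc)
  have "?h' \<odot> ?h = FArr T g' \<odot> ((c ?N \<odot> c ?N) \<odot> FArr T g)"
    by (simp add: Comp_assoc[OF h c Tg', symmetric] Comp_assoc[OF Tg c c])
  then have h'h: "?h' \<odot> ?h = \<one> (FObj T ?A)"
    by (simp add: cc Ident_Comp[OF Tg] Tg'Tg)
  have ph: "p (FObj T ?N) \<odot> ?h = (FArr T ^^ Suc n) (p M)"
    using Comp_assoc[OF Tg c pTN] p_c[OF N] F(4)[OF g p_hom[OF N]] pg by simp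
  \<comment> \<open>Composing \<open>p_c\<close> with the flip once more and using c c = 1 reverses
    its direction.\<close>
  have "FArr T (p ?N) \<odot> c ?N = p (FObj T ?N)"
    using Comp_assoc[OF c c pTN] cc Comp_Ident[OF pTN] p_c[OF N] by simp
  moreover have "c ?N \<odot> FArr T (g \<odot> w) = ?h \<odot> FArr T w" if "w \<in> hom C ?Q ?A" for w
    using F(4)[OF that g] Comp_assoc[OF F(2)[OF that] Tg c] by simp
  \<comment> \<open>T sends the square over p at N to one over T(p) at N. The flip, used as both
    \<open>i\<close> and \<open>j\<close> because it is an involution, changes the legs to p at TN
    and puts \<open>?h\<close> in front of the projections.\<close>
  ultimately have "is_pullback C (FObj T ?Q) (?h \<odot> FArr T ?a) (?h \<odot> FArr T ?b)
      (p (FObj T ?N)) (p (FObj T ?N))"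
    using is_pullback_iso_legs[OF T_preserves_pullback_of_p[OF N pbn] F(2)[OF p_hom[OF N]] c c cc cc]
      a b by simp
  with h h' hh' h'h ph show ?case
    by auto
qed

text \<open>Undoes the iterated flip: \<open>g'\<close> cancels \<open>g\<close> on the projections,
  while precomposing p at T^n M with \<open>g\<close> gives back T^n(p).\<close>

lemma T_pullback_of_p:
  assumes M: "M \<in> Obj C" and pb: "is_pullback C P a b (p M) (p M)"
  shows "T_pullback C T P a b (p M) (p M)"
  unfolding T_pullback_def
proof
  fix n
  let ?N = "(FObj T ^^ n) M" and ?A = "(FObj T ^^ n) (FObj T M)" and ?Q = "(FObj T ^^ n) P"
  obtain g g' where g: "g \<in> hom C ?A (FObj T ?N)" and g': "g' \<in> hom C (FObj T ?N) ?A"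
    and gg': "g \<odot> g' = \<one> (FObj T ?N)" and g'g: "g' \<odot> g = \<one> ?A"
    and pg: "p ?N \<odot> g = (FArr T ^^ n) (p M)"
    and pbn: "is_pullback C ?Q (g \<odot> (FArr T ^^ n) a) (g \<odot> (FArr T ^^ n) b) (p ?N) (p ?N)"
    using pow_pullback_of_p[OF M pb, of n] by blast
  have cancel: "g' \<odot> (g \<odot> (FArr T ^^ n) w) = (FArr T ^^ n) w" if "w \<in> hom C P (FObj T M)" for w
    using Comp_assoc[OF endofunctor_pow(2)[OF T_endofunctor that] g g'] g'g
      Ident_Comp[OF endofunctor_pow(2)[OF T_endofunctor that]] by simp
  have "a \<in> hom C P (FObj T M)" "b \<in> hom C P (FObj T M)"
    using pb p_hom[OF M] by (auto simp: is_pullback_def hom_iff)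
  then show "is_pullback C ?Q ((FArr T ^^ n) a) ((FArr T ^^ n) b)
      ((FArr T ^^ n) (p M)) ((FArr T ^^ n) (p M))"
    using is_pullback_iso_legs[OF pbn p_hom[OF endofunctor_pow(1)[OF T_endofunctor M]] g g' gg' g'g]
    by (simp add: cancel pg)
qed

lemma retraction_p: "M \<in> Obj C \<Longrightarrow> retraction C (p M)"
  using p_hom z_hom p_z unfolding retraction_def by (metis hom_iff)

lemma retraction_T_p:
  assumes M: "M \<in> Obj C"
  shows "retraction C (FArr T (p M))"
proof -
  note F = endofunctorD[OF T_endofunctor]
  have "FArr T (p M) \<odot> FArr T (z M) = \<one> (FObj T M)"
    using F(4)[OF z_hom[OF M] p_hom[OF M]] p_z[OF M] F(3)[OF M] by simp
  with F(2)[OF p_hom[OF M]] F(2)[OF z_hom[OF M]] show ?thesis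
    unfolding retraction_def by (metis hom_iff)
qed

lemma section_z: "M \<in> Obj C \<Longrightarrow> section_arr C (z M)"
  using p_hom z_hom p_z unfolding section_arr_def by (metis hom_iff)

end

section \<open>The dimension count\<close>

lemma tangent_dimensionD:
  assumes "tangent_dimension C T dim" and "T_pullback C T P a b r f"
    and "r \<in> hom C X Y" and "f \<in> hom C Z Y"
    and "retraction C r" and "retraction C f \<or> section_arr C f"
  shows "dim (iso_class C P) + dim (iso_class C Y) = dim (iso_class C X) + dim (iso_class C Z)"
  using assms unfolding tangent_dimension_def by blast

theorem theorem3p7:
  fixes C :: "('o, 'a, 'z) category_data_scheme"
    and T :: "('o, 'a) endofunctor_data"
    and p z add l c \<pi>\<^sub>0 \<pi>\<^sub>1 :: "'o \<Rightarrow> 'a"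
    and T2 :: "'o \<Rightarrow> 'o"
    and dim :: "'o set \<Rightarrow> 'm::comm_monoid_add"
    and X :: 'o
  assumes "tangent_category C T p T2 \<pi>\<^sub>0 \<pi>\<^sub>1 z add l c"
    and "tangent_dimension C T dim"
    and "X \<in> Obj C"
  shows "dim (iso_class C (FObj T (FObj T X))) + nat_mult 2 (dim (iso_class C X))
       = nat_mult 3 (dim (iso_class C (FObj T X)))"
proof -
  interpret tangent_category C T p T2 \<pi>\<^sub>0 \<pi>\<^sub>1 z add l c
    by (rule assms(1))
  note X = assms(3)
  let ?d = "\<lambda>A. dim (iso_class C A)"
  have lift: "?d (T2 X) + ?d (FObj T X) = ?d (FObj T (FObj T X)) + ?d X"
    using tangent_dimensionD[OF assms(2) lift_universal[OF X]
        endofunctorD(2)[OF T_endofunctor p_hom[OF X]] z_hom[OF X] retraction_T_p[OF X]]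
      section_z[OF X] by blast
  have square: "?d (T2 X) + ?d X = ?d (FObj T X) + ?d (FObj T X)"
    using tangent_dimensionD[OF assms(2) T_pullback_of_p[OF X T2_pullback[OF X]]
        p_hom[OF X] p_hom[OF X] retraction_p[OF X]] retraction_p[OF X] by blast
  \<comment> \<open>A commutative monoid need not be cancellative, so dim(T2 X) cannot be solved
    for. One copy of dim X is kept aside until the lift equation has produced dim(T2 X) + dim X,
    which \<open>square\<close> evaluates.\<close>
  have "?d (FObj T (FObj T X)) + (?d X + ?d X) = (?d (FObj T (FObj T X)) + ?d X) + ?d X"
    by (simp only: add.assoc)
  also have "\<dots> = (?d (T2 X) + ?d X) + ?d (FObj T X)"
    unfolding lift[symmetric] by (simp only: add_ac)
  finally show ?thesis
    by (simp add: square nat_mult_def numeral_eq_Suc)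
qed

end
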